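(* Let $(p_n)_{n\ge1}$ be a deterministic sequence in $[0,1]$, and let $g_n$ be the empirical distribution of the break points of the split-merge dynamics with splitting proportions $p_{n,k}=p_n$ for all $1\le k\le n$ (deterministic stratified case). Set $$s_n=\sum_{k=1}^n p_k(1-p_k)$$ and assume that $s_n\to\infty$ as $n\to\infty$. Then the sequence $(n g_n/\sqrt{s_n})$ of Radon measures on $(0,1)$ converges vaguely on $(0,1)$ to the Radon measure with density $Q'$ with respect to Lebesgue measure.
   Context: Given splitting proportions $(p_{n,k}:n\ge1,\ 1\le k\le n)$ in $[0,1]$, the break points of the split-merge dynamics are defined by $a_{n,0}=0$, $a_{n,n+1}=1$ for all $n\ge0$, and recursively for $n\ge1$, $$a_{n,k}=p_{n,k}\,a_{n-1,k-1}+(1-p_{n,k})\,a_{n-1,k},\qquad k=1,\dots,n.$$ The empirical distribution of the break points is $g_n=\frac1n\sum_{k=1}^n\delta_{a_{n,k}}$ for $n\ge1$, where $\delta_a$ is the unit mass at $a$; here it is restricted to $(0,1)$. $Q=\Phi^{-1}:(0,1)\to\mathbb{R}$ is the quantile function of the standard normal distribution, where $\Phi$ is the standard normal cumulative distribution function. Vague convergence on $(0,1)$ means convergence of integrals of every continuous function with compact support in $(0,1)$. *)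

theory Defs
  imports "HOL-Probability.Probability"
begin

text \<open>The break points a(n,k) are meaningful for k at most n + 1; beyond that index the value 1
  is a filler which the recursion never reaches from k at most n + 1.\<close>

fun break_point :: "(nat \<Rightarrow> nat \<Rightarrow> real) \<Rightarrow> nat \<Rightarrow> nat \<Rightarrow> real" where
  "break_point p 0 k = (if k = 0 then 0 else 1)"
| "break_point p (Suc n) k =
    (if k = 0 then 0
     else if k > Suc n then 1
     else p (Suc n) k * break_point p n (k - 1) + (1 - p (Suc n) k) * break_point p n k)"

lemma break_point_boundary: "break_point p n 0 = 0" "break_point p n (Suc n) = 1"
  by (cases n; simp)+

lemma break_point_rec:
  assumes "1 \<le> n" "1 \<le> k" "k \<le> n"
  shows "break_point p n k =
    p n k * break_point p (n - 1) (k - 1) + (1 - p n k) * break_point p (n - 1) k"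
  using assms by (cases n) auto

text \<open>The sum of the unit masses at a(n,1), ..., a(n,n) is the image of the counting measure on
  {1..n}; for n = 0 the definition below gives the zero measure.\<close>

definition break_empirical :: "(nat \<Rightarrow> nat \<Rightarrow> real) \<Rightarrow> nat \<Rightarrow> real measure" where
  "break_empirical p n =
    scale_measure (ennreal (1 / real n)) (distr (count_space {1..n}) borel (break_point p n))"

lemma sets_break_empirical [simp, measurable_cong]: "sets (break_empirical p n) = sets borel"
  by (simp add: break_empirical_def)

lemma emeasure_break_empirical:
  assumes "A \<in> sets borel"
  shows "emeasure (break_empirical p n) A =
    ennreal (1 / real n) * (\<Sum>k=1..n. emeasure (return borel (break_point p n k)) A)"
proof -
  let ?B = "{k \<in> {1..n}. break_point p n k \<in> A}"
  have "emeasure (distr (count_space {1..n}) borel (break_point p n)) A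
      = emeasure (count_space {1..n}) (break_point p n -` A \<inter> {1..n})"
    using assms by (simp add: emeasure_distr)
  also have "break_point p n -` A \<inter> {1..n} = ?B" by auto
  also have "emeasure (count_space {1..n}) ?B = of_nat (card ?B)"
    by (rule emeasure_count_space_finite) auto
  also have "\<dots> = (\<Sum>k=1..n. indicator A (break_point p n k))"
    by (simp add: indicator_def sum.If_cases Int_def)
  also have "\<dots> = (\<Sum>k=1..n. emeasure (return borel (break_point p n k)) A)"
    using assms by simp
  finally show ?thesis by (simp add: break_empirical_def)
qed

definition std_normal_cdf :: "real \<Rightarrow> real" where
  "std_normal_cdf = cdf (density lborel (\<lambda>x. ennreal (std_normal_density x)))"

text \<open>Only the values on the open interval (0,1) matter: there the distribution function, a
  bijection from the reals onto (0,1), is inverted.\<close>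

definition std_normal_quantile :: "real \<Rightarrow> real" where
  "std_normal_quantile = inv std_normal_cdf"

text \<open>Borel measures on S that are finite on compact sets. For the locally compact, second
  countable S used here (an open interval), regularity is then automatic.\<close>

definition radon_measure_on :: "real set \<Rightarrow> real measure \<Rightarrow> bool" where
  "radon_measure_on S M \<longleftrightarrow>
    sets M = sets (restrict_space borel S) \<and>
    (\<forall>K. compact K \<and> K \<subseteq> S \<longrightarrow> emeasure M K < \<infinity>)"

text \<open>The Radon requirement makes every test function integrable, so that no Bochner integral
  below takes its default value 0.\<close>

definition vague_conv_on :: "real set \<Rightarrow> (nat \<Rightarrow> real measure) \<Rightarrow> real measure \<Rightarrow> bool" where
  "vague_conv_on S M N \<longleftrightarrow>
    (\<forall>n. radon_measure_on S (M n)) \<and> radon_measure_on S N \<and>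
    (\<forall>f :: real \<Rightarrow> real.
      continuous_on S f \<and> compact (closure {x \<in> S. f x \<noteq> 0}) \<and> closure {x \<in> S. f x \<noteq> 0} \<subseteq> S \<longrightarrow>
      (\<lambda>n. integral\<^sup>L (M n) f) \<longlonglongrightarrow> integral\<^sup>L N f)"

end

theory Submission
  imports Defs "HOL-Real_Asymp.Real_Asymp"
begin

text \<open>The stratified split-merge recursion is the recursion, obtained by conditioning on the last trial, of
  a sum \<open>S\<^sub>n\<close> of independent Bernoulli variables with parameters \<open>p\<^sub>1, \<dots>, p\<^sub>n\<close>: the break point
  \<open>a\<^sub>n\<^sub>,\<^sub>k\<close> equals \<open>P(S\<^sub>n < k)\<close> (lemma \<open>break_point_eq_poisson_binomial_prob\<close>). The variance of \<open>S\<^sub>n\<close>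
  is \<open>s\<^sub>n\<close>, so the break points are the values of a distribution function that is nearly normal with
  standard deviation \<open>\<surd>s\<^sub>n\<close>, sampled at unit steps.

  Let \<open>G\<^sub>n\<close> be the distribution function of the standardised sum. It is a step function that
  takes the value \<open>a\<^sub>n\<^sub>,\<^sub>k\<close> on an interval of length \<open>1 / \<surd>s\<^sub>n\<close>. Hence, when \<open>s\<^sub>n > 0\<close>, for every \<open>f\<close> with compact support in \<open>(0,1)\<close>, extended
  by 0, the integral of \<open>f\<close> against \<open>n g\<^sub>n / \<surd>s\<^sub>n\<close> is exactly the Lebesgue integral of \<open>f(G\<^sub>n(u))\<close> over
  the real line (lemma \<open>integral_cdf_standardized_sum\<close>). As \<open>s\<^sub>n \<rightarrow> \<infinity>\<close>, the central limit theorem for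
  independent Bernoulli variables that need not be identically distributed (theorem
  \<open>standardized_sum_CLT\<close>, by characteristic functions and Levy's continuity theorem) gives
  \<open>G\<^sub>n(u) \<rightarrow> \<Phi>(u)\<close> for all \<open>u\<close>. Monotonicity of the \<open>G\<^sub>n\<close> confines the integrands to a fixed bounded
  interval, so dominated convergence yields the limit \<open>\<integral> f(\<Phi>(u)) du\<close> (lemma
  \<open>break_point_sums_tendsto\<close>). The substitution \<open>x = \<Phi>(u)\<close> turns this into \<open>\<integral> f(x) Q'(x) dx\<close> (lemma
  \<open>integral_quantile_measure\<close>).\<close>

section \<open>Break points as Poisson-binomial probabilities\<close>

text \<open>The law of the number of successes in \<open>n\<close> independent trials with success probabilities
  \<open>p 1, \<dots>, p n\<close>. Adding one trial at a time matches the recursion of the break points.\<close>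

primrec poisson_binomial_pmf :: "(nat \<Rightarrow> real) \<Rightarrow> nat \<Rightarrow> nat pmf" where
  "poisson_binomial_pmf p 0 = return_pmf 0"
| "poisson_binomial_pmf p (Suc n) =
    bernoulli_pmf (p (Suc n)) \<bind> (\<lambda>b. map_pmf (\<lambda>k. k + of_bool b) (poisson_binomial_pmf p n))"

lemma finite_set_poisson_binomial_pmf: "finite (set_pmf (poisson_binomial_pmf p n))"
  by (induction n) auto

lemma expectation_poisson_binomial_pmf_Suc:
  fixes h :: "nat \<Rightarrow> 'b::{banach, second_countable_topology}"
  assumes "0 \<le> p (Suc n)" "p (Suc n) \<le> 1"
  shows "measure_pmf.expectation (poisson_binomial_pmf p (Suc n)) h =
    p (Suc n) *\<^sub>R measure_pmf.expectation (poisson_binomial_pmf p n) (\<lambda>k. h (Suc k)) +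
    (1 - p (Suc n)) *\<^sub>R measure_pmf.expectation (poisson_binomial_pmf p n) h"
  using assms
  unfolding poisson_binomial_pmf.simps
  by (subst pmf_expectation_bind[where A = UNIV])
    (auto simp: finite_set_poisson_binomial_pmf UNIV_bool)

lemma break_point_beyond: "n < k \<Longrightarrow> break_point p n k = 1"
  by (cases n) auto

text \<open>Conditioning on the last trial, which succeeds with probability \<open>p\<close> and then leaves fewer than
  \<open>k - 1\<close> successes for the others, turns \<open>P(S\<^sub>n < k)\<close> into the very recursion that defines the
  break points. The values 0 at \<open>k = 0\<close> and 1 beyond \<open>k = n\<close> agree because \<open>0 \<le> S\<^sub>n \<le> n\<close>.\<close>

lemma break_point_eq_poisson_binomial_prob:
  assumes p: "\<And>n. n \<ge> 1 \<Longrightarrow> 0 \<le> p n \<and> p n \<le> 1"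
  shows "break_point (\<lambda>n k. p n) n k = measure_pmf.prob (poisson_binomial_pmf p n) {..<k}"
proof (induction n arbitrary: k)
  case 0
  show ?case by (simp add: indicator_def)
next
  case (Suc n)
  have bounds: "0 \<le> p (Suc n)" "p (Suc n) \<le> 1"
    using p[of "Suc n"] by auto
  have shift: "(\<lambda>j. indicator {..<k} (Suc j)) = (indicator {..<k - 1} :: nat \<Rightarrow> real)"
    by (auto simp: indicator_def fun_eq_iff)
  have "measure_pmf.prob (poisson_binomial_pmf p (Suc n)) {..<k}
      = measure_pmf.expectation (poisson_binomial_pmf p (Suc n)) (indicator {..<k})"
    by simp
  also have "\<dots> = p (Suc n) * measure_pmf.prob (poisson_binomial_pmf p n) {..<k - 1} +
      (1 - p (Suc n)) * measure_pmf.prob (poisson_binomial_pmf p n) {..<k}"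
    unfolding expectation_poisson_binomial_pmf_Suc[where p = p, OF bounds] shift by simp
  finally have rec: "measure_pmf.prob (poisson_binomial_pmf p (Suc n)) {..<k} =
      p (Suc n) * break_point (\<lambda>n k. p n) n (k - 1) + (1 - p (Suc n)) * break_point (\<lambda>n k. p n) n k"
    by (simp only: Suc.IH)
  show ?case
    unfolding rec by (auto simp: break_point_beyond break_point_boundary)
qed

text \<open>Centring is distributed over the trials, so that the factors are the characteristic functions of
  centred Bernoulli variables, whose linear Taylor terms vanish.\<close>

lemma expectation_iexp_poisson_binomial_pmf:
  fixes \<theta> :: real
  assumes p: "\<And>n. n \<ge> 1 \<Longrightarrow> 0 \<le> p n \<and> p n \<le> 1"
  shows "measure_pmf.expectation (poisson_binomial_pmf p n)
      (\<lambda>k. iexp (\<theta> * (real k - (\<Sum>i=1..n. p i)))) =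
    (\<Prod>i=1..n. of_real (p i) * iexp (\<theta> * (1 - p i)) + of_real (1 - p i) * iexp (- (\<theta> * p i)))"
proof (induction n)
  case (Suc n)
  let ?m = "\<Sum>i=1..n. p i"
  have bounds: "0 \<le> p (Suc n)" "p (Suc n) \<le> 1"
    using p[of "Suc n"] by auto
  have 1: "iexp (\<theta> * (real (Suc k) - (\<Sum>i=1..Suc n. p i)))
      = iexp (\<theta> * (real k - ?m)) * iexp (\<theta> * (1 - p (Suc n)))" for k
    by (simp add: exp_add[symmetric] algebra_simps)
  have 2: "iexp (\<theta> * (real k - (\<Sum>i=1..Suc n. p i)))
      = iexp (\<theta> * (real k - ?m)) * iexp (- (\<theta> * p (Suc n)))" for k
    by (simp add: exp_add[symmetric] algebra_simps)
  show ?case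
    unfolding expectation_poisson_binomial_pmf_Suc[where p = p, OF bounds] 1
    unfolding 2 integral_mult_left_zero Suc.IH
    by (simp add: scaleR_conv_of_real distrib_right mult_ac)
qed simp

section \<open>Central limit theorem for sums of Bernoulli variables\<close>

lemma exp_minus_quadratic_bound:
  fixes y :: real
  assumes "0 \<le> y"
  shows "\<bar>exp (- y) - (1 - y)\<bar> \<le> y\<^sup>2"
proof -
  have "1 - y \<le> exp (- y)"
    using exp_ge_add_one_self[of "- y"] by simp
  moreover have "exp (- y) \<le> 1 - y + y\<^sup>2"
  proof -
    have "exp (- y) = 1 / exp y"
      by (simp add: exp_minus field_simps)
    also have "\<dots> \<le> 1 / (1 + y)"
      using exp_ge_add_one_self[of y] assms by (intro divide_left_mono) auto
    also have "\<dots> \<le> 1 - y + y\<^sup>2"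
    proof -
      have "(1 - y + y\<^sup>2) * (1 + y) = 1 + y ^ 3"
        by (simp add: power2_eq_square power3_eq_cube algebra_simps)
      then show ?thesis
        using assms by (simp add: pos_divide_le_eq)
    qed
    finally show ?thesis .
  qed
  ultimately show ?thesis by auto
qed

lemma iexp_cubic_bound: "cmod (iexp x - (1 + \<i> * x - x\<^sup>2 / 2)) \<le> \<bar>x\<bar> ^ 3 / 6"
proof -
  have "(\<Sum>k\<le>2. (\<i> * complex_of_real x) ^ k / fact k) = 1 + \<i> * x - x\<^sup>2 / 2"
    by (simp add: numeral_2_eq_2 power2_eq_square field_simps)
  then show ?thesis
    using iexp_approx1[of x 2] by (simp add: numeral_3_eq_3 fact_numeral eval_nat_numeral)
qed

text \<open>A centred Bernoulli variable has mean 0 and variance \<open>p (1 - p)\<close>, so its characteristic function and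
  that of the normal law with the same variance have the same Taylor polynomial of order 2. The point
  of the bound is the factor \<open>p (1 - p)\<close> in front of the remainder: it is available because the third
  absolute moment is at most the variance, and it makes the errors of all trials add up to a
  multiple of the total variance.\<close>

lemma centered_bernoulli_char_bound:
  fixes p \<theta> :: real
  assumes p: "0 \<le> p" "p \<le> 1"
  shows "cmod (p * iexp (\<theta> * (1 - p)) + (1 - p) * iexp (- (\<theta> * p))
      - exp (- (p * (1 - p) * \<theta>\<^sup>2 / 2))) \<le> p * (1 - p) * (\<bar>\<theta>\<bar> ^ 3 + \<theta> ^ 4)"
proof -
  define q where "q = 1 - p"
  define T where "T x = 1 + \<i> * complex_of_real x - x\<^sup>2 / 2" for x :: real
  define y where "y = p * q * \<theta>\<^sup>2 / 2"
  have q: "0 \<le> q" "q \<le> 1" "p + q = 1" using p by (auto simp: q_def)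
  have pq: "0 \<le> p * q" "p * q \<le> 1"
    using p q by (auto simp: mult_le_one)
  have y0: "0 \<le> y" unfolding y_def using pq by simp
  \<comment> \<open>The linear terms cancel, and the quadratic ones combine to \<open>p q (p + q) \<theta>\<^sup>2 / 2\<close>.\<close>
  have taylor: "p * T (\<theta> * q) + q * T (- (\<theta> * p)) = of_real (1 - y)"
  proof -
    have "p * T (\<theta> * q) + q * T (- (\<theta> * p)) = of_real (p + q - p * q * (p + q) * \<theta>\<^sup>2 / 2)"
      by (simp add: T_def power2_eq_square algebra_simps add_divide_distrib)
    then show ?thesis using q by (simp add: y_def)
  qed
  have eq: "p * iexp (\<theta> * q) + q * iexp (- (\<theta> * p)) - exp (- y)
     = p * (iexp (\<theta> * q) - T (\<theta> * q)) + q * (iexp (- (\<theta> * p)) - T (- (\<theta> * p)))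
       - of_real (exp (- y) - (1 - y))"
    using taylor by (simp add: algebra_simps)
  have "cmod (p * iexp (\<theta> * q) + q * iexp (- (\<theta> * p)) - exp (- y))
     \<le> p * cmod (iexp (\<theta> * q) - T (\<theta> * q)) + q * cmod (iexp (- (\<theta> * p)) - T (- (\<theta> * p)))
       + \<bar>exp (- y) - (1 - y)\<bar>"
    unfolding eq using p q
    by (intro norm_triangle_le_diff norm_triangle_le add_mono) (auto simp: norm_mult simp flip: of_real_diff)
  also have "\<dots> \<le> p * (\<bar>\<theta> * q\<bar> ^ 3 / 6) + q * (\<bar>- (\<theta> * p)\<bar> ^ 3 / 6) + y\<^sup>2"
    unfolding T_def using p q y0
    by (intro add_mono mult_left_mono iexp_cubic_bound exp_minus_quadratic_bound) auto
  also have "\<dots> = p * q * ((q\<^sup>2 + p\<^sup>2) / 6 * \<bar>\<theta>\<bar> ^ 3) + p * q * (p * q / 4 * \<theta> ^ 4)"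
    using p q by (simp add: y_def abs_mult power_mult_distrib power2_eq_square power3_eq_cube
      power4_eq_xxxx field_simps)
  also have "\<dots> \<le> p * q * (1 * \<bar>\<theta>\<bar> ^ 3) + p * q * (1 * \<theta> ^ 4)"
  proof (intro add_mono mult_left_mono mult_right_mono)
    have "q\<^sup>2 \<le> 1" "p\<^sup>2 \<le> 1" using p q by (simp_all add: power_le_one)
    then show "(q\<^sup>2 + p\<^sup>2) / 6 \<le> 1" by simp
    show "p * q / 4 \<le> 1" using pq by simp
  qed (use pq in auto)
  finally show ?thesis by (simp add: q_def y_def algebra_simps)
qed

text \<open>The normalised law of the sum of independent Bernoulli variables with parameters \<open>p 1, \<dots>, p n\<close>,
  moved from the naturals to the Borel sets of the reals so that characteristic functions and
  weak convergence apply. If the variance vanishes, division by 0 makes it the point mass at 0.\<close>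

definition standardized_sum :: "(nat \<Rightarrow> real) \<Rightarrow> nat \<Rightarrow> real measure" where
  "standardized_sum p n = distr (poisson_binomial_pmf p n) borel
     (\<lambda>k. (real k - (\<Sum>i=1..n. p i)) / sqrt (\<Sum>i=1..n. p i * (1 - p i)))"

lemma real_distribution_standardized_sum: "real_distribution (standardized_sum p n)"
  unfolding standardized_sum_def
  by (intro prob_space.real_distribution_distr) (auto intro: prob_space_measure_pmf)

lemma char_standardized_sum:
  fixes p :: "nat \<Rightarrow> real" and \<theta> t :: real
  assumes p: "\<And>n. n \<ge> 1 \<Longrightarrow> 0 \<le> p n \<and> p n \<le> 1"
    and \<theta>: "\<theta> = t / sqrt (\<Sum>i=1..n. p i * (1 - p i))"
  shows "char (standardized_sum p n) t =
    (\<Prod>i=1..n. of_real (p i) * iexp (\<theta> * (1 - p i)) + of_real (1 - p i) * iexp (- (\<theta> * p i)))"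
proof -
  have "char (standardized_sum p n) t = measure_pmf.expectation (poisson_binomial_pmf p n)
      (\<lambda>k. iexp (\<theta> * (real k - (\<Sum>i=1..n. p i))))"
    unfolding char_def standardized_sum_def \<theta> by (simp add: integral_distr)
  also note expectation_iexp_poisson_binomial_pmf[OF p]
  finally show ?thesis .
qed

text \<open>The characteristic function of the standard normal law is the product of those of centred normal
  laws with the variances of the single trials. Two products of factors in the unit disc differ by at
  most the sum of the differences of the factors, and with \<open>\<theta> = t / \<surd>s\<close> that sum is at most
  \<open>s (\<bar>\<theta>\<bar>\<^sup>3 + \<theta>\<^sup>4)\<close>.\<close>

lemma char_standardized_sum_bound:
  fixes p :: "nat \<Rightarrow> real" and s t :: real
  assumes p: "\<And>n. n \<ge> 1 \<Longrightarrow> 0 \<le> p n \<and> p n \<le> 1"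
    and s: "s = (\<Sum>i=1..n. p i * (1 - p i))" "s > 0"
  shows "cmod (char (standardized_sum p n) t - char std_normal_distribution t)
    \<le> \<bar>t\<bar> ^ 3 / sqrt s + t ^ 4 / s"
proof -
  define \<theta> where "\<theta> = t / sqrt s"
  define z where "z i = of_real (p i) * iexp (\<theta> * (1 - p i)) + of_real (1 - p i) * iexp (- (\<theta> * p i))" for i
  define w where "w i = complex_of_real (exp (- (p i * (1 - p i) * \<theta>\<^sup>2 / 2)))" for i
  have bounds: "0 \<le> p i" "p i \<le> 1" if "i \<in> {1..n}" for i
    using p[of i] that by auto
  have "(\<Prod>i=1..n. w i) = complex_of_real (exp (- (s * \<theta>\<^sup>2 / 2)))"
    unfolding w_def s(1)
    by (simp flip: of_real_prod
      add: exp_sum[symmetric] sum_negf sum_distrib_right sum_divide_distrib)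
  also have "\<dots> = char std_normal_distribution t"
    using s(2) by (simp add: char_std_normal_distribution \<theta>_def power_divide)
  finally have w: "char std_normal_distribution t = (\<Prod>i=1..n. w i)" ..
  have z: "char (standardized_sum p n) t = (\<Prod>i=1..n. z i)"
    unfolding z_def by (rule char_standardized_sum[where p = p, OF p]) (simp_all add: \<theta>_def s)
  have "cmod ((\<Prod>i=1..n. z i) - (\<Prod>i=1..n. w i)) \<le> (\<Sum>i=1..n. cmod (z i - w i))"
  proof (rule norm_prod_diff)
    fix i assume i: "i \<in> {1..n}"
    have "cmod (z i) \<le> p i * 1 + (1 - p i) * 1"
      unfolding z_def using bounds[OF i]
      by (intro norm_triangle_le add_mono) (auto simp: norm_mult simp flip: of_real_diff)
    then show "cmod (z i) \<le> 1" by simp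
    show "cmod (w i) \<le> 1"
      unfolding w_def using bounds[OF i] by simp
  qed
  also have "\<dots> \<le> (\<Sum>i=1..n. p i * (1 - p i) * (\<bar>\<theta>\<bar> ^ 3 + \<theta> ^ 4))"
    unfolding z_def w_def using bounds by (intro sum_mono centered_bernoulli_char_bound) auto
  also have "\<dots> = s * (\<bar>\<theta>\<bar> ^ 3 + \<theta> ^ 4)"
    by (simp add: s sum_distrib_right)
  also have "\<dots> = \<bar>t\<bar> ^ 3 / sqrt s + t ^ 4 / s"
  proof -
    \<comment> \<open>In terms of the square root of \<open>s\<close> the identity is purely rational.\<close>
    define r where "r = sqrt s"
    have r: "r > 0" "s = r ^ 2" using s(2) by (auto simp: r_def)
    show ?thesis
      unfolding \<theta>_def r_def[symmetric] r(2) using r(1)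
      by (simp add: power_divide abs_divide power2_eq_square power3_eq_cube power4_eq_xxxx field_simps)
  qed
  finally show ?thesis unfolding z w .
qed

text \<open>Divergence of the variances alone suffices: the summands are uniformly bounded, and the error bound
  for the characteristic functions tends to 0 with \<open>1 / s\<^sub>n\<close>, whatever the individual \<open>p\<^sub>k\<close> are.\<close>

theorem standardized_sum_CLT:
  assumes p: "\<And>n. n \<ge> 1 \<Longrightarrow> 0 \<le> p n \<and> p n \<le> 1"
    and s: "filterlim (\<lambda>n. \<Sum>i=1..n. p i * (1 - p i)) at_top sequentially"
  shows "weak_conv_m (standardized_sum p) std_normal_distribution"
proof (rule levy_continuity)
  fix t
  let ?s = "\<lambda>n. \<Sum>i=1..n. p i * (1 - p i)"
  have "((\<lambda>s. \<bar>t\<bar> ^ 3 / sqrt s + t ^ 4 / s) \<longlongrightarrow> 0) at_top"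
    by real_asymp
  then have lim: "(\<lambda>n. \<bar>t\<bar> ^ 3 / sqrt (?s n) + t ^ 4 / ?s n) \<longlonglongrightarrow> 0"
    using s by (rule filterlim_compose)
  have "\<forall>\<^sub>F n in sequentially. ?s n > 0"
    using s by (auto simp: filterlim_at_top_dense)
  then have "\<forall>\<^sub>F n in sequentially. cmod (char (standardized_sum p n) t - char std_normal_distribution t)
      \<le> \<bar>t\<bar> ^ 3 / sqrt (?s n) + t ^ 4 / ?s n"
    by eventually_elim (rule char_standardized_sum_bound[OF p refl])
  then have "(\<lambda>n. char (standardized_sum p n) t - char std_normal_distribution t) \<longlonglongrightarrow> 0"
    using lim by (rule Lim_null_comparison)
  then show "(\<lambda>n. char (standardized_sum p n) t) \<longlonglongrightarrow> char std_normal_distribution t"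
    by (simp add: LIM_zero_iff)
qed (rule real_distribution_standardized_sum real_dist_normal_dist)+

section \<open>The normal quantile function and its density\<close>

text \<open>This expresses the distribution function by an integral over a compact interval, to which the
  fundamental theorem of calculus applies.\<close>

lemma std_normal_cdf_eq_integral:
  assumes "a < y"
  shows "std_normal_cdf y = std_normal_cdf a + integral {a..y} std_normal_density"
proof -
  interpret N: real_distribution std_normal_distribution
    by (rule real_dist_normal_dist)
  have int: "set_integrable lborel A std_normal_density" if "A \<in> sets lborel" for A
    using integrable_mult_indicator[OF that, of std_normal_density] by (simp add: set_integrable_def)
  have "std_normal_cdf y - std_normal_cdf a = measure std_normal_distribution {a<..y}"
    unfolding std_normal_cdf_def using assms
    by (intro finite_borel_measure.cdf_diff_eq N.finite_borel_measure_M)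
  also have "\<dots> = integral\<^sup>L std_normal_distribution (indicator {a<..y})"
    by simp
  also have "\<dots> = (LINT x:{a<..y}|lborel. std_normal_density x)"
    unfolding set_lebesgue_integral_def
    by (subst integral_density) (auto simp: mult.commute)
  also have "\<dots> = integral {a<..y} std_normal_density"
    by (intro set_borel_integral_eq_integral int) simp
  also have "\<dots> = integral {a..y} std_normal_density"
    by (rule integral_spike_set[OF negligible_subset[of "{a}"] negligible_subset[of "{a}"]]) auto
  finally show ?thesis by simp
qed

lemma has_real_derivative_std_normal_cdf:
  "(std_normal_cdf has_real_derivative std_normal_density x) (at x)"
proof -
  have cont: "continuous_on {x - 1..x + 1} std_normal_density"
    unfolding normal_density_def by (intro continuous_intros) auto
  have "((\<lambda>y. integral {x - 1..y} std_normal_density) has_real_derivative std_normal_density x)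
      (at x within {x - 1..x + 1})"
    by (rule integral_has_real_derivative[OF cont]) auto
  then have "((\<lambda>y. std_normal_cdf (x - 1) + integral {x - 1..y} std_normal_density)
      has_real_derivative std_normal_density x) (at x)"
    by (auto simp: at_within_Icc_at intro!: derivative_eq_intros)
  then show ?thesis
    by (rule has_field_derivative_transform_within_open[where S = "{x - 1<..<x + 1}"])
      (auto simp: std_normal_cdf_eq_integral[of "x - 1"])
qed

lemma isCont_std_normal_cdf: "isCont std_normal_cdf x"
  using has_real_derivative_std_normal_cdf by (rule DERIV_isCont)

lemma strict_mono_std_normal_cdf: "strict_mono std_normal_cdf"
proof (rule strict_monoI)
  fix x y :: real assume "x < y"
  then show "std_normal_cdf x < std_normal_cdf y"
    by (rule DERIV_pos_imp_increasing)
      (metis has_real_derivative_std_normal_cdf normal_density_pos zero_less_one)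
qed

lemma std_normal_cdf_bounds: "0 < std_normal_cdf x" "std_normal_cdf x < 1"
proof -
  interpret N: real_distribution std_normal_distribution
    by (rule real_dist_normal_dist)
  have "0 \<le> std_normal_cdf (x - 1)" "std_normal_cdf (x + 1) \<le> 1"
    using N.cdf_bounded_prob finite_borel_measure.cdf_nonneg[OF N.finite_borel_measure_M]
    by (auto simp: std_normal_cdf_def)
  then show "0 < std_normal_cdf x" "std_normal_cdf x < 1"
    using strict_monoD[OF strict_mono_std_normal_cdf, of "x - 1" x]
      strict_monoD[OF strict_mono_std_normal_cdf, of x "x + 1"] by auto
qed

lemma std_normal_cdf_surj:
  assumes "x \<in> {0<..<1}"
  shows "\<exists>u. std_normal_cdf u = x"
proof -
  interpret N: real_distribution std_normal_distribution
    by (rule real_dist_normal_dist)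
  have "\<forall>\<^sub>F u in at_bot. std_normal_cdf u < x"
    using order_tendstoD(2)[OF finite_borel_measure.cdf_lim_at_bot[OF N.finite_borel_measure_M]] assms
    by (simp add: std_normal_cdf_def)
  then obtain a where a: "std_normal_cdf a < x"
    by (auto simp: eventually_at_bot_linorder)
  have "\<forall>\<^sub>F u in at_top. x < std_normal_cdf u"
    using order_tendstoD(1)[OF N.cdf_lim_at_top_prob] assms by (simp add: std_normal_cdf_def)
  then obtain b where b: "x < std_normal_cdf b"
    by (auto simp: eventually_at_top_linorder)
  have "a \<le> b"
    using a b strict_mono_less[OF strict_mono_std_normal_cdf, of a b] by linarith
  then show ?thesis
    using IVT[of std_normal_cdf a x b] a b isCont_std_normal_cdf by auto
qed

lemma std_normal_quantile_cdf [simp]: "std_normal_quantile (std_normal_cdf u) = u"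
  unfolding std_normal_quantile_def
  by (rule inv_f_f) (rule strict_mono_imp_inj_on[OF strict_mono_std_normal_cdf])

lemma std_normal_cdf_quantile [simp]:
  "x \<in> {0<..<1} \<Longrightarrow> std_normal_cdf (std_normal_quantile x) = x"
  using std_normal_cdf_surj[of x] by auto

lemma isCont_std_normal_quantile:
  assumes "x \<in> {0<..<1}"
  shows "isCont std_normal_quantile x"
proof -
  have "isCont std_normal_quantile (std_normal_cdf (std_normal_quantile x))"
    by (rule isCont_inverse_function2[of "std_normal_quantile x - 1" _ "std_normal_quantile x + 1"])
      (auto simp: isCont_std_normal_cdf)
  then show ?thesis using assms by simp
qed

lemma deriv_std_normal_quantile:
  assumes "x \<in> {0<..<1}"
  shows "deriv std_normal_quantile x = 1 / std_normal_density (std_normal_quantile x)"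
proof -
  have "(std_normal_quantile has_real_derivative
      inverse (std_normal_density (std_normal_quantile x))) (at x)"
    by (rule DERIV_inverse_function[where f = std_normal_cdf and a = 0 and b = 1])
      (use assms isCont_std_normal_quantile normal_density_pos[of 1 0 "std_normal_quantile x"] in \<open>auto simp: has_real_derivative_std_normal_cdf\<close>)
  then show ?thesis
    by (simp add: DERIV_imp_deriv inverse_eq_divide)
qed

lemma deriv_std_normal_quantile_cdf:
  "deriv std_normal_quantile (std_normal_cdf u) = 1 / std_normal_density u"
  using std_normal_cdf_bounds by (simp add: deriv_std_normal_quantile)

lemma continuous_on_deriv_std_normal_quantile:
  "continuous_on {0<..<1} (deriv std_normal_quantile)"
proof -
  have "continuous_on {0<..<1} std_normal_quantile"
    by (rule continuous_at_imp_continuous_on) (auto simp: isCont_std_normal_quantile)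
  then have "continuous_on {0<..<1} (\<lambda>x. 1 / std_normal_density (std_normal_quantile x))"
    unfolding normal_density_def by (intro continuous_intros) auto
  then show ?thesis
    by (rule continuous_on_eq) (simp add: deriv_std_normal_quantile)
qed

lemma deriv_std_normal_quantile_nonneg:
  "x \<in> {0<..<1} \<Longrightarrow> 0 \<le> deriv std_normal_quantile x"
  by (simp add: deriv_std_normal_quantile)

abbreviation quantile_measure :: "real measure" where
  "quantile_measure \<equiv>
    density (restrict_space lborel {0<..<1}) (\<lambda>x. ennreal (deriv std_normal_quantile x))"

lemma borel_measurable_restrict_lborel:
  fixes f :: "real \<Rightarrow> real"
  assumes "continuous_on S f"
  shows "f \<in> borel_measurable (restrict_space lborel S)"
  using borel_measurable_continuous_on_restrict[OF assms]
  by (simp add: measurable_cong_sets[OF sets_restrict_space_cong[OF sets_lborel] refl])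

text \<open>The density is continuous on the open unit interval, hence bounded on compact subsets.\<close>

lemma radon_measure_on_quantile_measure: "radon_measure_on {0<..<1} quantile_measure"
  unfolding radon_measure_on_def
proof (intro conjI allI impI)
  show "sets quantile_measure = sets (restrict_space borel {0<..<1})"
    by (simp cong: sets_restrict_space_cong)
next
  fix K :: "real set" assume K: "compact K \<and> K \<subseteq> {0<..<1}"
  note [measurable] = borel_measurable_restrict_lborel[OF continuous_on_deriv_std_normal_quantile]
  have KS: "K \<in> sets borel" "K \<in> sets (restrict_space lborel {0<..<1})"
    using K by (auto simp: sets_restrict_space_iff compact_imp_closed)
  have "bounded (deriv std_normal_quantile ` K)"
    using K continuous_on_subset[OF continuous_on_deriv_std_normal_quantile]
    by (intro compact_imp_bounded compact_continuous_image) auto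
  then obtain B where B: "\<And>x. x \<in> K \<Longrightarrow> \<bar>deriv std_normal_quantile x\<bar> \<le> B"
    by (auto simp: bounded_iff)
  have "emeasure quantile_measure K
      = (\<integral>\<^sup>+x. ennreal (deriv std_normal_quantile x) * indicator K x \<partial>restrict_space lborel {0<..<1})"
    using KS by (subst emeasure_density) auto
  also have "\<dots> = (\<integral>\<^sup>+x. ennreal (deriv std_normal_quantile x) * indicator K x * indicator {0<..<1} x \<partial>lborel)"
    by (subst nn_integral_restrict_space) auto
  also have "\<dots> \<le> (\<integral>\<^sup>+x. ennreal B * indicator K x \<partial>lborel)"
  proof (rule nn_integral_mono)
    fix x
    have "deriv std_normal_quantile x \<le> B" if "x \<in> K"
      using B[OF that] by linarith
    then show "ennreal (deriv std_normal_quantile x) * indicator K x * indicator {0<..<1} x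
        \<le> ennreal B * indicator K x"
      by (cases "x \<in> K") (auto simp: indicator_def intro: ennreal_leI)
  qed
  also have "\<dots> = ennreal B * emeasure lborel K"
    using KS by (simp add: nn_integral_cmult_indicator)
  also have "\<dots> < \<infinity>"
    using K emeasure_compact_finite[of K] by (simp add: ennreal_mult_less_top)
  finally show "emeasure quantile_measure K < \<infinity>" .
qed

text \<open>Substituting \<open>x = \<Phi>(u)\<close> cancels the density: \<open>Q'(\<Phi>(u)) \<Phi>'(u) = 1\<close>. Thus \<open>Q'(x) dx\<close> is the image
  of Lebesgue measure on the real line under \<open>\<Phi>\<close>. A compact support keeps the substitution within
  a bounded interval.\<close>

lemma integral_quantile_measure:
  fixes f :: "real \<Rightarrow> real"
  assumes f: "continuous_on {0<..<1} f"
    and ab: "a \<le> b"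
    and supp: "\<And>x. x \<in> {0<..<1} \<Longrightarrow> f x \<noteq> 0 \<Longrightarrow> x \<in> {std_normal_cdf a..std_normal_cdf b}"
  shows "integral\<^sup>L quantile_measure f = (LINT u|lborel. indicator {a..b} u * f (std_normal_cdf u))"
proof -
  let ?I = "{std_normal_cdf a..std_normal_cdf b}"
  let ?q = "deriv std_normal_quantile"
  have I: "?I \<subseteq> {0<..<1}"
    using std_normal_cdf_bounds(1)[of a] std_normal_cdf_bounds(2)[of b] by auto
  note meas [measurable] = borel_measurable_restrict_lborel[OF f]
    borel_measurable_restrict_lborel[OF continuous_on_deriv_std_normal_quantile]
  have cont: "continuous_on ?I (\<lambda>x. f x * ?q x)"
    by (intro continuous_intros continuous_on_subset[OF _ I] f continuous_on_deriv_std_normal_quantile)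
  have "integral\<^sup>L quantile_measure f = (LINT x|restrict_space lborel {0<..<1}. ?q x *\<^sub>R f x)"
    by (rule integral_density) (auto intro!: AE_I2 deriv_std_normal_quantile_nonneg simp: space_restrict_space)
  also have "\<dots> = (LINT x|lborel. indicator {0<..<1} x *\<^sub>R (?q x *\<^sub>R f x))"
    by (rule integral_restrict_space) simp
  also have "\<dots> = (LINT x|lborel. f x * ?q x * indicator ?I x)"
    using supp I by (intro Bochner_Integration.integral_cong) (auto simp: indicator_def)
  also have "\<dots> = (LINT u|lborel. f (std_normal_cdf u) * ?q (std_normal_cdf u) * std_normal_density u * indicator {a..b} u)"
  proof (rule integral_substitution(2)[where f = "\<lambda>x. f x * ?q x" and g = std_normal_cdf])
    show "set_integrable lborel ?I (\<lambda>x. f x * ?q x)"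
      by (rule borel_integrable_atLeastAtMost'[OF cont])
    show "continuous_on {a..b} std_normal_density"
      unfolding normal_density_def by (intro continuous_intros) auto
  qed (use ab has_real_derivative_std_normal_cdf in auto)
  also have "\<dots> = (LINT u|lborel. indicator {a..b} u * f (std_normal_cdf u))"
    using normal_density_pos[of 1 0]
    by (intro Bochner_Integration.integral_cong)
      (auto simp: deriv_std_normal_quantile_cdf less_imp_neq[symmetric])
  finally show ?thesis .
qed

section \<open>Integrals against the empirical distribution\<close>

lemma integral_scale_measure:
  fixes f :: "'a \<Rightarrow> real"
  assumes c: "0 \<le> c" and f: "f \<in> borel_measurable M"
  shows "integral\<^sup>L (scale_measure (ennreal c) M) f = c * integral\<^sup>L M f"
proof -
  have "scale_measure (ennreal c) M = density M (\<lambda>_. ennreal c)"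
    by (rule measure_eqI) (simp_all add: emeasure_density_const)
  then show ?thesis
    using c f by (simp add: integral_density)
qed

lemma radon_measure_on_scaled_break_empirical:
  assumes S: "S \<in> sets borel"
  shows "radon_measure_on S (scale_measure (ennreal c) (restrict_space (break_empirical p n) S))"
  unfolding radon_measure_on_def
proof (intro conjI allI impI)
  show "sets (scale_measure (ennreal c) (restrict_space (break_empirical p n) S))
      = sets (restrict_space borel S)"
    by (simp cong: sets_restrict_space_cong)
next
  fix K assume K: "compact K \<and> K \<subseteq> S"
  then have KB: "K \<in> sets borel"
    by (simp add: compact_imp_closed)
  have "(\<Sum>k=1..n. emeasure (return borel (break_point p n k)) K) \<le> (\<Sum>k=1..n. 1)"
    using KB by (intro sum_mono) (auto simp: indicator_def)
  also have "\<dots> < \<infinity>"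
    by (simp add: of_nat_less_top)
  finally have "emeasure (break_empirical p n) K < \<infinity>"
    using KB by (simp add: emeasure_break_empirical ennreal_mult_less_top)
  moreover have "emeasure (restrict_space (break_empirical p n) S) K = emeasure (break_empirical p n) K"
    using K S by (intro emeasure_restrict_space) auto
  ultimately show "emeasure (scale_measure (ennreal c) (restrict_space (break_empirical p n) S)) K < \<infinity>"
    by (simp add: ennreal_mult_less_top)
qed

text \<open>The normalisation \<open>1 / n\<close> of the empirical distribution cancels the factor \<open>n\<close>. The formula remains
  true for \<open>n = 0\<close>, where both sides are 0, and for \<open>r = 0\<close>, where division by 0 yields 0 on both sides.\<close>

lemma integral_scaled_break_empirical:
  fixes f :: "real \<Rightarrow> real"
  assumes S: "S \<in> sets borel" and f: "continuous_on S f" and r: "0 \<le> r"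
  shows "integral\<^sup>L (scale_measure (ennreal (real n / r)) (restrict_space (break_empirical p n) S)) f
    = (\<Sum>k=1..n. indicator S (break_point p n k) * f (break_point p n k)) / r"
proof -
  let ?h = "\<lambda>x. indicator S x *\<^sub>R f x"
  have h [measurable]: "?h \<in> borel_measurable borel"
    using S f by (rule borel_measurable_continuous_on_indicator)
  have fm: "f \<in> borel_measurable (restrict_space (break_empirical p n) S)"
    using borel_measurable_continuous_on_restrict[OF f]
    by (simp add: measurable_cong_sets[OF sets_restrict_space_cong[OF sets_break_empirical] refl])
  have "integral\<^sup>L (scale_measure (ennreal (real n / r)) (restrict_space (break_empirical p n) S)) f
      = real n / r * integral\<^sup>L (break_empirical p n) ?h"
    using S r by (subst integral_scale_measure[OF _ fm]) (simp_all add: integral_restrict_space)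
  also have "integral\<^sup>L (break_empirical p n) ?h
      = 1 / real n * integral\<^sup>L (distr (count_space {1..n}) borel (break_point p n)) ?h"
    unfolding break_empirical_def by (rule integral_scale_measure) (use h in simp_all)
  also have "integral\<^sup>L (distr (count_space {1..n}) borel (break_point p n)) ?h
      = (\<Sum>k=1..n. ?h (break_point p n k))"
    by (subst integral_distr) (use h in \<open>simp_all add: lebesgue_integral_count_space_finite\<close>)
  finally show ?thesis by simp
qed

section \<open>Break points as steps of a distribution function\<close>

lemma poisson_binomial_cdf_eq_break_point:
  assumes p: "\<And>n. n \<ge> 1 \<Longrightarrow> 0 \<le> p n \<and> p n \<le> 1"
  shows "measure_pmf.prob (poisson_binomial_pmf p n) {j. real j \<le> x} =
    (if x < 0 then 0 else break_point (\<lambda>n k. p n) n (Suc (nat \<lfloor>x\<rfloor>)))"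
proof (cases "x < 0")
  case True
  then have "{j. real j \<le> x} = {}" by auto
  then show ?thesis using True by simp
next
  case False
  then have "{j. real j \<le> x} = {..<Suc (nat \<lfloor>x\<rfloor>)}"
    by (auto simp: less_Suc_eq_le le_nat_floor le_nat_iff le_floor_iff)
  then show ?thesis
    using False by (simp add: break_point_eq_poisson_binomial_prob[where p = p, OF p])
qed

text \<open>The distribution function of an integer-valued variable is constant on \<open>[k - 1, k)\<close>, with value
  \<open>P(S\<^sub>n < k)\<close> there; outside \<open>[0, n)\<close> it is 0 or 1, where \<open>h\<close> vanishes. As all steps have length 1,
  integrating over \<open>x\<close> will produce the sum of \<open>h\<close> over the break points.\<close>

lemma poisson_binomial_cdf_step_sum:
  fixes h :: "real \<Rightarrow> real"
  assumes p: "\<And>n. n \<ge> 1 \<Longrightarrow> 0 \<le> p n \<and> p n \<le> 1"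
    and h: "h 0 = 0" "h 1 = 0"
  shows "h (measure_pmf.prob (poisson_binomial_pmf p n) {j. real j \<le> x}) =
    (\<Sum>k=1..n. h (break_point (\<lambda>n k. p n) n k) * indicator {real k - 1..<real k} x)"
proof (cases "x < 0")
  case True
  then show ?thesis
    using h by (simp add: poisson_binomial_cdf_eq_break_point[where p = p, OF p] indicator_def)
next
  case False
  define m where "m = Suc (nat \<lfloor>x\<rfloor>)"
  let ?a = "break_point (\<lambda>n k. p n) n"
  have ind: "indicator {real k - 1..<real k} x = (if k = m then 1 else 0 :: real)" for k
  proof -
    have "x \<in> {real k - 1..<real k} \<longleftrightarrow> \<lfloor>x\<rfloor> = int k - 1"
      by (auto simp: floor_eq_iff)
    also have "\<lfloor>x\<rfloor> = int m - 1"
      using False by (simp add: m_def)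
    also have "int m - 1 = int k - 1 \<longleftrightarrow> k = m"
      by auto
    finally show ?thesis by (simp add: indicator_def)
  qed
  have "(\<Sum>k=1..n. h (?a k) * indicator {real k - 1..<real k} x) = (if m \<in> {1..n} then h (?a m) else 0)"
    unfolding ind by (simp add: if_distrib[of "(*) _"] sum.delta cong: if_cong)
  also have "\<dots> = h (?a m)"
    using h by (auto simp: break_point_beyond m_def)
  finally show ?thesis
    using False by (simp add: poisson_binomial_cdf_eq_break_point[where p = p, OF p] m_def)
qed

lemma cdf_standardized_sum:
  assumes "\<sigma> = sqrt (\<Sum>i=1..n. p i * (1 - p i))" "\<sigma> > 0"
  shows "cdf (standardized_sum p n) u =
    measure_pmf.prob (poisson_binomial_pmf p n) {j. real j \<le> (\<Sum>i=1..n. p i) + \<sigma> * u}"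
proof -
  have "cdf (standardized_sum p n) u =
      measure_pmf.prob (poisson_binomial_pmf p n) ((\<lambda>k. (real k - (\<Sum>i=1..n. p i)) / \<sigma>) -` {..u})"
    unfolding cdf_def standardized_sum_def assms(1)[symmetric] by (simp add: measure_distr)
  also have "(\<lambda>k. (real k - (\<Sum>i=1..n. p i)) / \<sigma>) -` {..u} = {j. real j \<le> (\<Sum>i=1..n. p i) + \<sigma> * u}"
    using assms(2) by (auto simp: pos_divide_le_eq algebra_simps)
  finally show ?thesis .
qed

text \<open>Here the scaling by \<open>\<sigma>\<close> enters: standardising the variable shrinks the unit steps of its distribution
  function to length \<open>1 / \<sigma>\<close>, which is the weight that each break point receives.\<close>

lemma
  fixes h :: "real \<Rightarrow> real"
  assumes p: "\<And>n. n \<ge> 1 \<Longrightarrow> 0 \<le> p n \<and> p n \<le> 1"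
    and h: "h 0 = 0" "h 1 = 0"
    and \<sigma>: "\<sigma> = sqrt (\<Sum>i=1..n. p i * (1 - p i))" "\<sigma> > 0"
  shows borel_measurable_cdf_standardized_sum:
      "(\<lambda>u. h (cdf (standardized_sum p n) u)) \<in> borel_measurable borel"
    and integral_cdf_standardized_sum:
      "(LINT u|lborel. h (cdf (standardized_sum p n) u)) =
        (\<Sum>k=1..n. h (break_point (\<lambda>n k. p n) n k)) / \<sigma>"
proof -
  let ?a = "break_point (\<lambda>n k. p n) n"
  define m where "m = (\<Sum>i=1..n. p i)"
  define step where "step x = (\<Sum>k=1..n. h (?a k) * indicator {real k - 1..<real k} x)" for x
  have eq: "h (cdf (standardized_sum p n) u) = step (m + \<sigma> * u)" for u
    unfolding cdf_standardized_sum[OF \<sigma>] step_def m_def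
    by (rule poisson_binomial_cdf_step_sum[where p = p, OF p h])
  have step [measurable]: "step \<in> borel_measurable borel"
    unfolding step_def by measurable
  show "(\<lambda>u. h (cdf (standardized_sum p n) u)) \<in> borel_measurable borel"
    unfolding eq by measurable
  have "(LINT x|lborel. step x) = (\<Sum>k=1..n. h (?a k))"
    unfolding step_def by (subst Bochner_Integration.integral_sum) auto
  moreover have "(LINT x|lborel. step x) = \<sigma> * (LINT u|lborel. step (m + \<sigma> * u))"
    using lborel_integral_real_affine[of \<sigma> step m] \<sigma>(2) by simp
  ultimately show "(LINT u|lborel. h (cdf (standardized_sum p n) u)) = (\<Sum>k=1..n. h (?a k)) / \<sigma>"
    unfolding eq using \<sigma>(2) by (simp add: field_simps)
qed

section \<open>Vague convergence of the break points\<close>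

text \<open>Weak convergence gives pointwise convergence of distribution functions at every \<open>u\<close>, since the
  limit is continuous.\<close>

lemma cdf_standardized_sum_tendsto:
  assumes p: "\<And>n. n \<ge> 1 \<Longrightarrow> 0 \<le> p n \<and> p n \<le> 1"
    and s: "filterlim (\<lambda>n. \<Sum>i=1..n. p i * (1 - p i)) at_top sequentially"
  shows "(\<lambda>n. cdf (standardized_sum p n) u) \<longlonglongrightarrow> std_normal_cdf u"
  using standardized_sum_CLT[where p = p, OF p s] isCont_std_normal_cdf[of u]
  by (simp add: weak_conv_m_def weak_conv_def std_normal_cdf_def)

text \<open>By the step representation the left-hand side is, for all large \<open>n\<close>, the integral of \<open>h \<circ> G\<^sub>n\<close>, where \<open>G\<^sub>n\<close> is the distribution
  function of the standardised sum and \<open>h\<close> is \<open>f\<close> extended by 0. The central limit theorem gives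
  \<open>h \<circ> G\<^sub>n \<rightarrow> h \<circ> \<Phi>\<close> pointwise. Domination comes from monotonicity: once \<open>G\<^sub>n(a) < \<alpha>\<close> and \<open>G\<^sub>n(b) > \<beta>\<close> at
  two fixed points \<open>a\<close> and \<open>b\<close>, the integrand vanishes outside \<open>[a, b]\<close>.\<close>

lemma break_point_sums_tendsto:
  fixes f :: "real \<Rightarrow> real"
  assumes p: "\<And>n. n \<ge> 1 \<Longrightarrow> 0 \<le> p n \<and> p n \<le> 1"
    and s: "filterlim (\<lambda>n. \<Sum>i=1..n. p i * (1 - p i)) at_top sequentially"
    and f: "continuous_on {0<..<1} f"
    and ab: "0 < \<alpha>" "\<alpha> \<le> \<beta>" "\<beta> < 1"
    and supp: "\<And>x. x \<in> {0<..<1} \<Longrightarrow> f x \<noteq> 0 \<Longrightarrow> x \<in> {\<alpha>..\<beta>}"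
  shows "(\<lambda>n. (\<Sum>k=1..n. indicator {0<..<1} (break_point (\<lambda>n k. p n) n k) * f (break_point (\<lambda>n k. p n) n k))
      / sqrt (\<Sum>i=1..n. p i * (1 - p i))) \<longlonglongrightarrow> integral\<^sup>L quantile_measure f"
proof -
  define h where "h x = indicator {0<..<1} x * f x" for x :: real
  \<comment> \<open>The shift by 1 makes the inequalities at the ends of the window strict, so that they are
    inherited by the approximating distribution functions.\<close>
  define a where "a = std_normal_quantile \<alpha> - 1"
  define b where "b = std_normal_quantile \<beta> + 1"
  let ?G = "\<lambda>n. cdf (standardized_sum p n)"
  let ?\<sigma> = "\<lambda>n. sqrt (\<Sum>i=1..n. p i * (1 - p i))"
  have h01: "h 0 = 0" "h 1 = 0" by (simp_all add: h_def)
  have h_supp: "h x = 0" if "x \<notin> {\<alpha>..\<beta>}" for x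
    using supp[of x] that by (auto simp: h_def indicator_def)
  have "std_normal_cdf a < std_normal_cdf (std_normal_quantile \<alpha>)"
    by (rule strict_monoD[OF strict_mono_std_normal_cdf]) (simp add: a_def)
  then have a: "std_normal_cdf a < \<alpha>" using ab by simp
  have "std_normal_cdf (std_normal_quantile \<beta>) < std_normal_cdf b"
    by (rule strict_monoD[OF strict_mono_std_normal_cdf]) (simp add: b_def)
  then have b: "\<beta> < std_normal_cdf b" using ab by simp
  have "std_normal_cdf a < std_normal_cdf b" using a b ab by linarith
  then have "a \<le> b"
    by (simp add: strict_mono_less[OF strict_mono_std_normal_cdf])
  have "bounded (f ` {\<alpha>..\<beta>})"
    using ab by (intro compact_imp_bounded compact_continuous_image continuous_on_subset[OF f]) auto
  then obtain B where B: "\<And>x. x \<in> {\<alpha>..\<beta>} \<Longrightarrow> \<bar>f x\<bar> \<le> B"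
    unfolding bounded_iff by (metis imageI real_norm_def)
  have "0 \<le> B" using B[of \<alpha>] ab by auto
  have h_bound: "\<bar>h x\<bar> \<le> B" for x
    using B[of x] h_supp[of x] \<open>0 \<le> B\<close> by (cases "x \<in> {\<alpha>..\<beta>}") (auto simp: h_def indicator_def)
  have lim: "(\<lambda>n. ?G n u) \<longlonglongrightarrow> std_normal_cdf u" for u
    by (rule cdf_standardized_sum_tendsto[where p = p, OF p s])
  have h_cont: "isCont h (std_normal_cdf u)" for u
  proof -
    have "std_normal_cdf u \<in> {0<..<1}" using std_normal_cdf_bounds[of u] by auto
    moreover have "continuous_on {0<..<1} h"
      using f by (rule continuous_on_eq) (simp add: h_def)
    ultimately show ?thesis by (simp add: continuous_on_eq_continuous_at)
  qed
  have pos: "\<forall>\<^sub>F n in sequentially. ?\<sigma> n > 0"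
    using s by (auto simp: filterlim_at_top_dense)
  have meas: "\<forall>\<^sub>F n in sequentially. (\<lambda>u. h (?G n u)) \<in> borel_measurable borel"
    using pos by eventually_elim (rule borel_measurable_cdf_standardized_sum[where p = p, OF p h01 refl])
  have outside: "\<forall>\<^sub>F n in sequentially. \<forall>u. u \<notin> {a..b} \<longrightarrow> h (?G n u) = 0"
  proof -
    have "\<forall>\<^sub>F n in sequentially. ?G n a < \<alpha>" "\<forall>\<^sub>F n in sequentially. \<beta> < ?G n b"
      using order_tendstoD(2)[OF lim a] order_tendstoD(1)[OF lim b] by auto
    then show ?thesis
    proof eventually_elim
      case (elim n)
      show ?case
      proof (intro allI impI)
        fix u assume "u \<notin> {a..b}"
        then have "u \<le> a \<or> b \<le> u" by auto
        moreover have "?G n x \<le> ?G n y" if "x \<le> y" for x y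
          using that real_distribution_standardized_sum[of p n]
          by (intro finite_borel_measure.cdf_nondecreasing real_distribution.finite_borel_measure_M)
        ultimately have "?G n u < \<alpha> \<or> \<beta> < ?G n u"
          using elim by (meson le_less_trans less_le_trans)
        then show "h (?G n u) = 0"
          using ab by (intro h_supp) auto
      qed
    qed
  qed
  \<comment> \<open>Dropping finitely many terms leaves only those with positive variance, whose integrands are
    known to be measurable.\<close>
  obtain N where N: "\<And>n. n \<ge> N \<Longrightarrow> (\<lambda>u. h (?G n u)) \<in> borel_measurable borel"
    using meas by (auto simp: eventually_sequentially)
  have "(\<lambda>n. LINT u|lborel. indicator {a..b} u * h (?G (n + N) u))
      \<longlonglongrightarrow> (LINT u|lborel. indicator {a..b} u * h (std_normal_cdf u))"
  proof (rule integral_dominated_convergence[where w = "\<lambda>u. B * indicator {a..b} u"])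
    have hG: "(\<lambda>n. h (?G (n + N) u)) \<longlonglongrightarrow> h (std_normal_cdf u)" for u
      using isCont_tendsto_compose[OF h_cont lim] by (rule LIMSEQ_ignore_initial_segment)
    show "AE u in lborel. (\<lambda>n. indicator {a..b} u * h (?G (n + N) u))
        \<longlonglongrightarrow> indicator {a..b} u * h (std_normal_cdf u)"
      by (intro AE_I2 tendsto_mult_left hG)
    have [measurable]: "(\<lambda>u. h (?G (n + N) u)) \<in> borel_measurable borel" for n
      by (rule N) simp
    show "(\<lambda>u. indicator {a..b} u * h (?G (n + N) u)) \<in> borel_measurable lborel" for n
      by measurable
    have "(\<lambda>u. h (std_normal_cdf u)) \<in> borel_measurable borel"
      by (rule borel_measurable_LIMSEQ_real[OF hG]) measurable
    then show "(\<lambda>u. indicator {a..b} u * h (std_normal_cdf u)) \<in> borel_measurable lborel"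
      by measurable
    show "integrable lborel (\<lambda>u. B * indicator {a..b} u)"
      using \<open>a \<le> b\<close> by (intro integrable_mult_right integrable_real_indicator) simp_all
    show "AE u in lborel. norm (indicator {a..b} u * h (?G (n + N) u)) \<le> B * indicator {a..b} u" for n
      using h_bound by (auto simp: indicator_def)
  qed
  then have "(\<lambda>n. LINT u|lborel. indicator {a..b} u * h (?G n u))
      \<longlonglongrightarrow> (LINT u|lborel. indicator {a..b} u * h (std_normal_cdf u))"
    by (rule LIMSEQ_offset)
  also have "(LINT u|lborel. indicator {a..b} u * h (std_normal_cdf u)) = integral\<^sup>L quantile_measure f"
  proof -
    have "x \<in> {std_normal_cdf a..std_normal_cdf b}" if "x \<in> {0<..<1}" "f x \<noteq> 0" for x
      using supp[OF that] a b by auto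
    then show ?thesis
      using integral_quantile_measure[OF f \<open>a \<le> b\<close>] std_normal_cdf_bounds by (simp add: h_def)
  qed
  finally show ?thesis
  proof (rule Lim_transform_eventually)
    show "\<forall>\<^sub>F n in sequentially. (LINT u|lborel. indicator {a..b} u * h (?G n u)) =
        (\<Sum>k=1..n. indicator {0<..<1} (break_point (\<lambda>n k. p n) n k) * f (break_point (\<lambda>n k. p n) n k)) / ?\<sigma> n"
      using pos outside
    proof eventually_elim
      case (elim n)
      have "(LINT u|lborel. indicator {a..b} u * h (?G n u)) = (LINT u|lborel. h (?G n u))"
        using elim(2) by (intro Bochner_Integration.integral_cong) (auto simp: indicator_def)
      also have "\<dots> = (\<Sum>k=1..n. h (break_point (\<lambda>n k. p n) n k)) / ?\<sigma> n"
        by (rule integral_cdf_standardized_sum[where p = p, OF p h01 refl elim(1)])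
      finally show ?case by (simp add: h_def)
    qed
  qed
qed

theorem theorem4p3:
  fixes p :: "nat \<Rightarrow> real"
  assumes "\<And>n. n \<ge> 1 \<Longrightarrow> 0 \<le> p n \<and> p n \<le> 1"
    and "filterlim (\<lambda>n. \<Sum>k=1..n. p k * (1 - p k)) at_top sequentially"
  shows "vague_conv_on {0<..<1}
    (\<lambda>n. scale_measure (ennreal (real n / sqrt (\<Sum>k=1..n. p k * (1 - p k))))
           (restrict_space (break_empirical (\<lambda>n k. p n) n) {0<..<1}))
    (density (restrict_space lborel {0<..<1}) (\<lambda>x. ennreal (deriv std_normal_quantile x)))"
  unfolding vague_conv_on_def
proof (intro conjI allI impI)
  fix f :: "real \<Rightarrow> real"
  assume f: "continuous_on {0<..<1} f \<and> compact (closure {x \<in> {0<..<1}. f x \<noteq> 0}) \<and>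
    closure {x \<in> {0<..<1}. f x \<noteq> 0} \<subseteq> {0<..<1}"
  \<comment> \<open>The extra point keeps \<open>K\<close> nonempty when \<open>f\<close> vanishes.\<close>
  define K where "K = insert (1 / 2) (closure {x \<in> {0<..<1}. f x \<noteq> 0})"
  have K: "compact K" "K \<noteq> {}" "K \<subseteq> {0<..<1}"
    using f by (auto simp: K_def)
  obtain \<alpha> where \<alpha>: "\<alpha> \<in> K" "\<And>x. x \<in> K \<Longrightarrow> \<alpha> \<le> x"
    using compact_attains_inf[OF K(1,2)] by auto
  obtain \<beta> where \<beta>: "\<beta> \<in> K" "\<And>x. x \<in> K \<Longrightarrow> x \<le> \<beta>"
    using compact_attains_sup[OF K(1,2)] by auto
  have supp: "x \<in> {\<alpha>..\<beta>}" if "x \<in> {0<..<1}" "f x \<noteq> 0" for x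
  proof -
    have "x \<in> K"
      using that closure_subset[of "{x \<in> {0<..<1}. f x \<noteq> 0}"] by (auto simp: K_def)
    then show ?thesis using \<alpha>(2) \<beta>(2) by simp
  qed
  have ab: "0 < \<alpha>" "\<alpha> \<le> \<beta>" "\<beta> < 1"
    using \<alpha>(1) \<beta> K(3) by auto
  have s_nonneg: "0 \<le> sqrt (\<Sum>k=1..n. p k * (1 - p k))" for n
    using assms(1) by (intro real_sqrt_ge_zero sum_nonneg) auto
  show "(\<lambda>n. integral\<^sup>L (scale_measure (ennreal (real n / sqrt (\<Sum>k=1..n. p k * (1 - p k))))
          (restrict_space (break_empirical (\<lambda>n k. p n) n) {0<..<1})) f)
      \<longlonglongrightarrow> integral\<^sup>L quantile_measure f"
    using break_point_sums_tendsto[where p = p, OF assms conjunct1[OF f] ab supp] f s_nonneg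
    by (simp add: integral_scaled_break_empirical)
qed (simp_all add: radon_measure_on_scaled_break_empirical radon_measure_on_quantile_measure)

end
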